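(* Let $d$ be a non-zero integer and let $f(x)=x^2+d$. Then $\lambda(n^2+d)$ changes sign infinitely often (as $n$ runs through the positive integers).
   Context: The Liouville function is $\lambda(n)=(-1)^{\Omega(n)}$ for positive integers $n$, where $\Omega(n)$ is the number of prime factors of $n$ counted with multiplicity (so $\lambda(1)=1$, $\lambda(p)=-1$ for each prime $p$, and $\lambda$ is completely multiplicative). "$\lambda(f(n))$ changes sign infinitely often" means that, among positive integers $n$ with $f(n)>0$, $\lambda(f(n))=1$ for infinitely many $n$ and $\lambda(f(n))=-1$ for infinitely many $n$. *)

theory Defs
  imports "HOL-Number_Theory.Number_Theory"
begin

definition prime_omega :: "nat \<Rightarrow> nat" where
  "prime_omega n = size (prime_factorization n)"

text \<open>
  Only the values at positive arguments are meaningful; the convention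
  \<open>prime_factorization 0 = {#}\<close> makes the value at 0 equal to 1.
\<close>
definition liouville :: "nat \<Rightarrow> int" where
  "liouville n = (-1) ^ prime_omega n"

lemma liouville_1: "liouville 1 = 1"
  by (simp add: liouville_def prime_omega_def)

lemma liouville_prime: "prime p \<Longrightarrow> liouville p = -1"
  by (simp add: liouville_def prime_omega_def prime_factorization_prime)

lemma liouville_mult: "m > 0 \<Longrightarrow> n > 0 \<Longrightarrow> liouville (m * n) = liouville m * liouville n"
  by (simp add: liouville_def prime_omega_def prime_factorization_mult power_add)

text \<open>
  The guard \<open>f (int n) > 0\<close> keeps the truncation of negative values by \<open>nat\<close>, and
  the meaningless value of \<open>liouville\<close> at 0, out of both sets.
\<close>
definition liouville_changes_sign_inf_often :: "(int \<Rightarrow> int) \<Rightarrow> bool" where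
  "liouville_changes_sign_inf_often f \<longleftrightarrow>
     infinite {n::nat. n > 0 \<and> f (int n) > 0 \<and> liouville (nat (f (int n))) = 1} \<and>
     infinite {n::nat. n > 0 \<and> f (int n) > 0 \<and> liouville (nat (f (int n))) = -1}"

end

theory Submission
  imports Defs "HOL-Computational_Algebra.Polynomial_Factorial" "HOL-Library.Discrete_Functions"
begin

text \<open>
  Write \<open>f n = n\<^sup>2 + d\<close>, and call \<open>x\<^sup>2 + d * y\<^sup>2\<close> the norm of the pair \<open>(x, y)\<close>, which stands for
  \<open>x + y * sqrt (- d)\<close> with a formal square root. The multiplicativity of the norm drives everything.

  The value \<open>1\<close> recurs because of the identity \<open>f n * f (n + 1) = f (n * (n + 1) + d)\<close>: if
  \<open>liouville\<close> were eventually \<open>-1\<close> along \<open>f\<close>, the left-hand side would have value \<open>1\<close> and the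
  right-hand side value \<open>-1\<close>.

  Suppose, for the value \<open>-1\<close>, that \<open>liouville\<close> is eventually \<open>1\<close> along \<open>f\<close>. When
  \<open>u * y - x * v = 1\<close>, the product of the norms of \<open>(x, y)\<close> and \<open>(u, v)\<close> is a value of \<open>f\<close>, so both
  norms have the same Liouville value, as long as that value of \<open>f\<close> is taken at a large argument.
  Descending through Farey neighbours gives the value \<open>1\<close> to the norm of every nonzero \<open>(x, y)\<close> with
  \<open>\<bar>x\<bar> \<ge> M * \<bar>y\<bar>\<close>, where \<open>M\<close> is a large constant (\<open>liouville_norm_cone\<close>). Multiplying by the square
  of an element of \<open>\<int>[sqrt (- d)]\<close> only multiplies the norm by a square, and every element of positive
  norm can be moved into that cone in this way (\<open>rotate_into_cone\<close>); so every positive norm has the value \<open>1\<close>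
  (\<open>liouville_norm_eq_1\<close>).

  This is absurd, because some positive norm has the value \<open>-1\<close>. If \<open>- d\<close> is not a square and
  \<open>\<bar>d\<bar> > 1\<close>, take a prime \<open>p\<close> modulo which some element has order \<open>8 * \<bar>d\<bar>\<close>
  (\<open>exists_prime_with_element_of_order\<close>). Then \<open>p\<close> is \<open>1\<close> modulo \<open>8 * \<bar>d\<bar>\<close>, so \<open>- d\<close> is a square
  modulo \<open>p\<close> by quadratic reciprocity (\<open>QuadRes_of_order\<close>), and a pigeonhole argument shows that
  \<open>p * k\<^sup>2\<close> is a norm for some \<open>k \<noteq> 0\<close> (\<open>square_class_of_prime_is_norm\<close>). In the remaining cases
  \<open>d = - k\<^sup>2\<close> and \<open>d = 1\<close>, the norms \<open>8 * k\<^sup>2\<close> and \<open>2\<close> do.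
\<close>

section \<open>The Liouville function on norms\<close>

lemma liouville_cases: "liouville n = 1 \<or> liouville n = -1"
  by (simp add: liouville_def minus_one_power_iff)

lemma liouville_nat_mult:
  fixes a b :: int
  assumes "a > 0" "b > 0"
  shows "liouville (nat (a * b)) = liouville (nat a) * liouville (nat b)"
  using assms by (simp add: nat_mult_distrib liouville_mult)

lemma liouville_nat_square_mult:
  fixes a k :: int
  assumes "a > 0" "k \<noteq> 0"
  shows "liouville (nat (k^2 * a)) = liouville (nat a)"
proof -
  have "k^2 = \<bar>k\<bar> * \<bar>k\<bar>" by (simp add: power2_eq_square)
  then have "liouville (nat (k^2)) = liouville (nat \<bar>k\<bar>) * liouville (nat \<bar>k\<bar>)"
    using assms(2) by (metis liouville_nat_mult zero_less_abs_iff)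
  also have "\<dots> = 1" using liouville_cases[of "nat \<bar>k\<bar>"] by auto
  finally show ?thesis using assms by (simp add: liouville_nat_mult)
qed

lemma norm_mult_identity:
  fixes x y u v d :: "'a::comm_ring_1"
  shows "(x^2 + d * y^2) * (u^2 + d * v^2) = (x * u + d * y * v)^2 + d * (u * y - x * v)^2"
  by (simp add: power2_eq_square algebra_simps)

text \<open>
  In the cone \<open>\<bar>x\<bar> \<ge> M * \<bar>y\<bar>\<close> the square \<open>x\<^sup>2\<close> outweighs \<open>d * y\<^sup>2\<close> whatever the sign of \<open>d\<close>.
  This is what lets the definite and the indefinite form be treated together.
\<close>
lemma norm_cone_pos:
  fixes x y d M :: int
  assumes "M \<ge> \<bar>d\<bar> + 1" "\<bar>x\<bar> \<ge> M * \<bar>y\<bar>" "x \<noteq> 0"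
  shows "x^2 + d * y^2 > 0"
proof (cases "y = 0")
  case False
  have "M * \<bar>y\<bar> \<ge> 0" using assms(1) by simp
  then have "(M * \<bar>y\<bar>)^2 \<le> \<bar>x\<bar>^2" using assms(2) by (rule power_mono[rotated])
  then have "M^2 * y^2 \<le> x^2" by (simp add: power_mult_distrib)
  moreover have "-d < M^2"
  proof -
    have "M * 1 \<le> M * M" using assms(1) by (intro mult_left_mono) auto
    then show ?thesis using assms(1) by (simp add: power2_eq_square)
  qed
  then have "-d * y^2 < M^2 * y^2" using False by (intro mult_strict_right_mono) auto
  ultimately show ?thesis by simp
qed (use assms in simp)

text \<open>
  The fraction \<open>u / v\<close> is a Farey neighbour of \<open>x / y\<close> with smaller denominator. Of the two such
  neighbours this is the larger one, so that the condition \<open>x \<ge> M * y\<close> passes from \<open>(x, y)\<close> to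
  \<open>(u, v)\<close>.
\<close>
lemma upper_farey_neighbour:
  fixes x y :: int
  assumes "coprime x y" "x > 0" "y > 0"
  obtains u v where "u * y - x * v = 1" "0 \<le> v" "v < y" "u > 0"
proof -
  obtain w where w: "[x * w = 1] (mod y)" using assms(1) cong_solve_coprime_int by blast
  define v where "v = (- w) mod y"
  have v: "0 \<le> v" "v < y" using assms by (auto simp: v_def)
  have "[x * v = x * (-w)] (mod y)" unfolding v_def by (intro cong_mult) auto
  also have "x * (-w) = - (x * w)" by simp
  also have "[- (x * w) = -1] (mod y)" using w by (simp add: cong_minus_minus_iff)
  finally have "y dvd x * v - (-1)" by (simp add: cong_iff_dvd_diff)
  then obtain u where u: "1 + x * v = y * u" by (auto simp: add.commute elim: dvdE)
  have "x * v \<ge> 0" using assms v by simp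
  then have "y * u > 0" using u by linarith
  then have "u > 0" using assms by (simp add: zero_less_mult_iff)
  with u v show ?thesis by (intro that[of u v]) (auto simp: algebra_simps)
qed

text \<open>
  Descent on \<open>y\<close>. By \<open>norm_mult_identity\<close> the norms of \<open>(x, y)\<close> and of its neighbour \<open>(u, v)\<close>
  multiply to \<open>n\<^sup>2 + d\<close> with \<open>n = x * u + d * y * v\<close>, and the cone condition forces \<open>n \<ge> M \<ge> N\<close>.
  Hence the two norms have the same Liouville value; the descent ends at the norm of \<open>(1, 0)\<close>.
\<close>
lemma liouville_norm_coprime_cone:
  fixes d N M x y :: int
  assumes ev: "\<And>n. n \<ge> N \<Longrightarrow> n^2 + d > 0 \<Longrightarrow> liouville (nat (n^2 + d)) = 1"
  assumes M: "M \<ge> N" "M \<ge> \<bar>d\<bar> + 1"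
  assumes "coprime x y" "y \<ge> 0" "x \<ge> M * y" "x > 0"
  shows "liouville (nat (x^2 + d * y^2)) = 1"
  using assms(4-)
proof (induction "nat y" arbitrary: x y rule: less_induct)
  case less
  have x: "x > 0" by fact
  consider "y = 0" | "y > 0" using less.prems by linarith
  then show ?case
  proof cases
    case 1
    then have "x = 1" using less.prems by simp
    with 1 show ?thesis using liouville_1 by simp
  next
    case 2
    obtain u v where uv: "u * y - x * v = 1" "0 \<le> v" "v < y" "u > 0"
      using upper_farey_neighbour less.prems 2 by blast
    have cop: "coprime u v"
    proof (rule coprimeI)
      fix c assume "c dvd u" "c dvd v"
      then have "c dvd u * y - x * v" by simp
      then show "is_unit c" using uv(1) by simp
    qed
    have "u \<ge> M * v"
    proof -
      have "M * v * y \<le> x * v" using less.prems(3) uv(2) 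
        by (metis mult.commute mult.left_commute mult_left_mono)
      also have "\<dots> < u * y" using uv(1) by simp
      finally show ?thesis using 2 by (simp add: mult_less_cancel_right)
    qed
    have IH: "liouville (nat (u^2 + d * v^2)) = 1"
      using less.hyps uv cop \<open>u \<ge> M * v\<close> by auto
    define n where "n = x * u + d * y * v"
    have "n \<ge> M"
    proof (cases "v = 0")
      case True
      have "M * 1 \<le> M * y" using 2 M by (intro mult_left_mono) auto
      also have "\<dots> \<le> x * 1" using less.prems by simp
      also have "\<dots> \<le> x * u" using uv x by (intro mult_left_mono) auto
      finally show ?thesis using True by (simp add: n_def)
    next
      case False
      have "(M * y) * (M * v) \<le> x * u"
        using less.prems \<open>u \<ge> M * v\<close> M 2 uv by (intro mult_mono) auto
      moreover have "M \<le> (M * M - \<bar>d\<bar>) * (y * v)"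
      proof -
        have "M * M \<ge> M * (\<bar>d\<bar> + 1)" using M by (intro mult_left_mono) auto
        moreover have "M * \<bar>d\<bar> \<ge> 1 * \<bar>d\<bar>" using M by (intro mult_right_mono) auto
        ultimately have "M \<le> M * M - \<bar>d\<bar>" by (simp add: algebra_simps)
        moreover have "1 * 1 \<le> y * v" using 2 False uv by (intro mult_mono) auto
        ultimately have "M * 1 \<le> (M * M - \<bar>d\<bar>) * (y * v)" using M by (intro mult_mono) auto
        then show ?thesis by simp
      qed
      moreover have "- \<bar>d\<bar> * (y * v) \<le> d * (y * v)"
        using 2 uv by (intro mult_right_mono) auto
      ultimately show ?thesis unfolding n_def by (simp add: algebra_simps)
    qed
    have pos: "x^2 + d * y^2 > 0" "u^2 + d * v^2 > 0"
      using norm_cone_pos[of d M] M less.prems uv \<open>u \<ge> M * v\<close> by auto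
    have prod: "(x^2 + d * y^2) * (u^2 + d * v^2) = n^2 + d"
      unfolding norm_mult_identity n_def uv(1) by simp
    then have "n^2 + d > 0" using pos by (metis mult_pos_pos)
    then have "liouville (nat (n^2 + d)) = 1" using ev M \<open>n \<ge> M\<close> by simp
    then show ?thesis using IH pos by (simp add: prod[symmetric] liouville_nat_mult)
  qed
qed

lemma liouville_norm_cone:
  fixes d N M x y :: int
  assumes ev: "\<And>n. n \<ge> N \<Longrightarrow> n^2 + d > 0 \<Longrightarrow> liouville (nat (n^2 + d)) = 1"
  assumes M: "M \<ge> N" "M \<ge> \<bar>d\<bar> + 1"
  assumes xy: "\<bar>x\<bar> \<ge> M * \<bar>y\<bar>" "x \<noteq> 0"
  shows "liouville (nat (x^2 + d * y^2)) = 1"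
proof -
  define g where "g = gcd x y"
  have "g > 0" using xy by (simp add: g_def)
  define x' y' where "x' = \<bar>x\<bar> div g" and "y' = \<bar>y\<bar> div g"
  have eq: "\<bar>x\<bar> = g * x'" "\<bar>y\<bar> = g * y'" by (auto simp: x'_def y'_def g_def)
  have "coprime x' y'" unfolding x'_def y'_def g_def
    using xy by (metis abs_eq_0 div_gcd_coprime gcd_abs1_int gcd_abs2_int)
  moreover have "x' > 0" using eq xy \<open>g > 0\<close> by (metis zero_less_abs_iff zero_less_mult_pos)
  moreover have "y' \<ge> 0" using \<open>g > 0\<close> by (simp add: y'_def pos_imp_zdiv_nonneg_iff)
  moreover have "x' \<ge> M * y'"
  proof -
    have "g * (M * y') \<le> g * x'" using xy(1) eq by (simp add: mult.left_commute)
    then show ?thesis using \<open>g > 0\<close> by simp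
  qed
  ultimately have "liouville (nat (x'^2 + d * y'^2)) = 1" "x'^2 + d * y'^2 > 0"
    using liouville_norm_coprime_cone[OF ev M, of x' y'] norm_cone_pos[OF M(2), where x = x' and y = y'] by auto
  moreover have "x^2 + d * y^2 = g^2 * (x'^2 + d * y'^2)"
  proof -
    have "x^2 + d * y^2 = \<bar>x\<bar>^2 + d * \<bar>y\<bar>^2" by simp
    also have "\<dots> = g^2 * (x'^2 + d * y'^2)" unfolding eq by (simp add: algebra_simps power_mult_distrib)
    finally show ?thesis .
  qed
  ultimately show ?thesis using \<open>g > 0\<close> by (simp add: liouville_nat_square_mult)
qed

text \<open>
  Multiplication by \<open>(r + sqrt (- d))\<^sup>2\<close> turns \<open>x + y * sqrt (- d)\<close> into
  \<open>X r + Y r * sqrt (- d)\<close> for two polynomials \<open>X\<close> and \<open>Y\<close> of degree at most two. For \<open>y \<noteq> 0\<close>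
  a quarter of the discriminant of \<open>Y\<close> is the norm \<open>x\<^sup>2 + d * y\<^sup>2\<close>, which is positive, hence \<open>Y\<close> has a
  real root \<open>r0\<close>. There \<open>X r0 \<noteq> 0\<close>, so at any rational
  \<open>a / b\<close> close enough to \<open>r0\<close> the ratio of \<open>Y\<close> to \<open>X\<close> is as small as desired; the element
  \<open>(a + b * sqrt (- d))\<^sup>2\<close> does the rotation.
\<close>
lemma rotate_into_cone:
  fixes d x y M :: int
  assumes "d \<noteq> 0" "x^2 + d * y^2 > 0"
  obtains X Y c where "c \<noteq> 0" "X^2 + d * Y^2 = c^2 * (x^2 + d * y^2)" "\<bar>X\<bar> \<ge> M * \<bar>Y\<bar>"
proof (cases "y = 0")
  case True
  then show ?thesis by (intro that[of 1 x 0]) auto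
next
  case False
  \<comment> \<open>the numerator of \<open>r0\<close> solves \<open>(y * r + x)\<^sup>2 = D\<close>, which is \<open>y * Y r = 0\<close>\<close>
  define D r0 where "D = x^2 + d * y^2" and "r0 = (sqrt (real_of_int D) - x) / y"
  have D: "real_of_int D = real_of_int x^2 + real_of_int d * real_of_int y^2" by (simp add: D_def)
  define X Y where "X r = x * (r^2 - d) - 2 * d * y * r" and "Y r = y * (r^2 - d) + 2 * x * r"
    for r :: real
  have "y * r0 + x = sqrt D" using False by (simp add: r0_def)
  then have "(y * r0 + x)^2 = real_of_int D" using assms unfolding D_def
    by (metis of_int_0_le_iff order_less_imp_le real_sqrt_pow2)
  then have "y * Y r0 = 0"
    unfolding D Y_def by (simp add: power2_eq_square algebra_simps)
  then have Y0: "Y r0 = 0" using False by simp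
  have XY: "X r^2 + d * Y r^2 = real_of_int D * (r^2 + d)^2" for r :: real
    unfolding X_def Y_def D by (simp add: power2_eq_square algebra_simps)
  have D0: "real_of_int D > 0" using assms by (simp only: D_def of_int_0_less_iff)
  \<comment> \<open>the multiplier must not have norm zero, also for rational parameters near \<open>r0\<close>\<close>
  have c0: "r0^2 + d \<noteq> 0"
  proof
    assume "r0^2 + d = 0"
    then have r: "r0^2 = - d" by simp
    have "x * r0 = d * y" using Y0 unfolding Y_def r by (simp add: algebra_simps)
    then have "(x * r0)^2 = (d * y)^2" by simp
    then have "x^2 * (r0^2) = (d^2 * y^2 :: real)" by (simp add: power_mult_distrib)
    then have "real_of_int d * real_of_int D = 0" unfolding r D by (simp add: algebra_simps power2_eq_square)
    with assms(1) D0 show False by simp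
  qed
  define f where "f r = \<bar>X r\<bar> - M * \<bar>Y r\<bar>" for r
  have "isCont (\<lambda>r. f r) r0" "isCont (\<lambda>r. r^2 + real_of_int d) r0"
    unfolding f_def X_def Y_def by (intro continuous_intros)+
  moreover have "f r0 > 0"
  proof -
    have "X r0 ^ 2 \<noteq> 0" using XY[of r0] c0 D0 unfolding Y0 by simp
    then show ?thesis by (simp add: f_def Y0)
  qed
  ultimately have "eventually (\<lambda>r. f r > 0) (nhds r0)" "eventually (\<lambda>r. r^2 + real_of_int d \<noteq> 0) (nhds r0)"
    using c0 by (auto simp: isCont_def tendsto_nhds_iff intro: order_tendstoD tendsto_imp_eventually_ne)
  then have "eventually (\<lambda>r. f r > 0 \<and> r^2 + real_of_int d \<noteq> 0) (nhds r0)"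
    by (rule eventually_conj)
  then obtain e where e: "e > 0" "\<And>r. dist r r0 < e \<Longrightarrow> f r > 0 \<and> r^2 + real_of_int d \<noteq> 0"
    by (auto simp: eventually_nhds_metric)
  obtain q :: rat where "r0 < of_rat q" "of_rat q < r0 + e"
    using of_rat_dense[of r0 "r0 + e"] e by auto
  then have q: "f (of_rat q) > 0" "(of_rat q)^2 + real_of_int d \<noteq> 0"
    using e(2)[of "of_rat q"] by (auto simp: dist_real_def)
  obtain a b where ab: "q = of_int a / of_int b" "b > 0"
    by (metis Fract_of_int_quotient Rat_cases)
  \<comment> \<open>the values of \<open>X\<close> and \<open>Y\<close> at \<open>a / b\<close>, with the denominator \<open>b\<^sup>2\<close> cleared\<close>
  define A B where "A = x * (a^2 - d * b^2) - 2 * d * y * a * b"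
    and "B = y * (a^2 - d * b^2) + 2 * x * a * b"
  have qr: "(of_rat q :: real) = a / b" by (simp add: ab of_rat_divide)
  have A: "real_of_int A = b^2 * X (of_rat q)" and B: "real_of_int B = b^2 * Y (of_rat q)"
    using ab(2) unfolding A_def B_def X_def Y_def qr by (simp_all add: field_simps power2_eq_square)
  show ?thesis
  proof (rule that[of "a^2 + d * b^2" A B])
    show "A^2 + d * B^2 = (a^2 + d * b^2)^2 * (x^2 + d * y^2)"
      unfolding A_def B_def by (simp add: power2_eq_square algebra_simps)
    show "a^2 + d * b^2 \<noteq> 0"
    proof
      assume "a^2 + d * b^2 = 0"
      then have "real_of_int (a^2 + d * b^2) = 0" by simp
      then have "(a / b)^2 + real_of_int d = 0" using ab(2) by (simp add: field_simps)
      with q(2) qr show False by simp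
    qed
    have "0 < b^2 * f (of_rat q)" using q(1) ab(2) by simp
    also have "\<dots> = \<bar>real_of_int A\<bar> - M * \<bar>real_of_int B\<bar>"
      unfolding A B f_def by (simp add: abs_mult algebra_simps)
    finally have "real_of_int (M * \<bar>B\<bar>) < real_of_int \<bar>A\<bar>" by simp
    then show "M * \<bar>B\<bar> \<le> \<bar>A\<bar>" unfolding of_int_less_iff by simp
  qed
qed

lemma liouville_norm_eq_1:
  fixes d N x y :: int
  assumes ev: "\<And>n. n \<ge> N \<Longrightarrow> n^2 + d > 0 \<Longrightarrow> liouville (nat (n^2 + d)) = 1"
  assumes pos: "d \<noteq> 0" "x^2 + d * y^2 > 0"
  shows "liouville (nat (x^2 + d * y^2)) = 1"
proof -
  define M where "M = max N (\<bar>d\<bar> + 1)"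
  obtain X Y c where XY: "c \<noteq> 0" "X^2 + d * Y^2 = c^2 * (x^2 + d * y^2)" "\<bar>X\<bar> \<ge> M * \<bar>Y\<bar>"
    using rotate_into_cone[OF pos] by blast
  have "X \<noteq> 0"
  proof
    assume "X = 0"
    then have "M * \<bar>Y\<bar> \<le> 0" using XY(3) by simp
    then have "Y = 0" by (auto simp: M_def mult_le_0_iff)
    with \<open>X = 0\<close> XY pos show False by simp
  qed
  then have "liouville (nat (X^2 + d * Y^2)) = 1"
    using XY by (intro liouville_norm_cone[of N d M] ev) (auto simp: M_def)
  then show ?thesis using XY pos by (simp add: liouville_nat_square_mult)
qed

section \<open>Primes with an element of prescribed order\<close>

lemma of_int_poly_mult:
  "map_poly of_int (P * Q) = (map_poly of_int P * map_poly of_int Q :: 'a::comm_ring_1 poly)"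
  by (intro poly_eqI) (simp add: coeff_map_poly coeff_mult)

text \<open>
  As \<open>\<int>[X]\<close> is a unique factorisation domain and \<open>\<complex>\<close> has no zero divisors, one of the prime factors
  must account for the root.
\<close>
lemma prime_factor_with_root:
  fixes P :: "int poly" and z :: complex
  assumes "P \<noteq> 0" "poly (map_poly of_int P) z = 0"
  obtains Q where "prime Q" "Q dvd P" "poly (map_poly of_int Q) z = 0"
proof -
  have "P \<noteq> 0 \<longrightarrow> poly (map_poly of_int P) z = 0 \<longrightarrow>
     (\<exists>Q. prime Q \<and> Q dvd P \<and> poly (map_poly of_int Q) z = 0)"
  proof (induction P rule: prime_divisors_induct)
    case zero
    then show ?case by simp
  next
    case (unit P)
    then obtain c where "P = [:c:]" "c dvd 1" by (auto simp: is_unit_poly_iff)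
    then show ?case by (auto simp: map_poly_pCons)
  next
    case (factor Q P)
    show ?case
    proof (intro impI)
      assume "Q * P \<noteq> 0" "poly (map_poly of_int (Q * P)) z = 0"
      then have "P \<noteq> 0" "poly (map_poly of_int Q) z = 0 \<or> poly (map_poly of_int P) z = 0"
        by (auto simp: of_int_poly_mult)
      with factor show "\<exists>R. prime R \<and> R dvd Q * P \<and> poly (map_poly of_int R) z = 0"
        by (meson dvd_triv_left dvd_mult)
    qed
  qed
  with assms that show ?thesis by blast
qed

lemma nonunit_value_at_multiple:
  fixes Q :: "int poly"
  assumes "degree Q > 0" "n > 0"
  obtains k :: nat where "\<not> is_unit (poly Q (int (n * k)))" "poly Q (int (n * k)) \<noteq> 0"
proof -
  have ne: "Q - [:c:] \<noteq> 0" for c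
    using assms(1) by (metis degree_pCons_0 eq_iff_diff_eq_0 less_numeral_extra(3))
  have "finite (\<Union>c\<in>{0,1,-1}. {x. poly (Q - [:c:]) x = 0})"
    using poly_roots_finite[OF ne] by blast
  moreover have "infinite ((\<lambda>k. int (n * k)) ` UNIV)"
    using assms(2) by (subst finite_image_iff) (auto simp: inj_on_def)
  ultimately have "\<not> (\<lambda>k. int (n * k)) ` UNIV \<subseteq> (\<Union>c\<in>{0,1,-1}. {x. poly (Q - [:c:]) x = 0})"
    using finite_subset by blast
  then obtain k where "int (n * k) \<notin> (\<Union>c\<in>{0,1,-1}. {x. poly (Q - [:c:]) x = 0})"
    by auto
  then show ?thesis using that[of k] by (auto simp: zdvd1_eq abs_if split: if_splits)
qed

text \<open>
  A substitute for the cyclotomic polynomial is any prime factor \<open>Q\<close> of \<open>X ^ n - 1\<close> in \<open>\<int>[X]\<close> that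
  has a primitive \<open>n\<close>-th root of unity as a root. For a proper divisor \<open>m = n div q\<close> with \<open>q\<close> prime,
  \<open>Q\<close> does not divide \<open>X ^ m - 1\<close>, so it divides the cofactor \<open>R = \<Sum>i<q. X ^ (m * i)\<close>. Let \<open>p\<close> be a
  prime divisor of \<open>Q(a)\<close>, where \<open>a\<close> is a multiple of \<open>n\<close>. If the order of \<open>a\<close> modulo \<open>p\<close> divided
  \<open>m\<close>, then \<open>R(a)\<close> would be congruent to \<open>q\<close>, so that \<open>p = q\<close> would divide \<open>n\<close>, hence \<open>a\<close>; but \<open>a\<close> is
  invertible modulo \<open>p\<close>.
\<close>
lemma exists_prime_with_element_of_order:
  fixes n :: nat
  assumes n: "n > 0"
  obtains p a :: nat where "prime p" "ord p a = n"
proof -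
  define F where "F m = monom 1 m - (1 :: int poly)" for m
  define z where "z = cis (2 * pi / real n)"
  have ev: "poly (map_poly of_int (F m)) z = z ^ m - 1" for m
  proof -
    have "map_poly of_int (F m) = monom 1 m - (1 :: complex poly)"
      by (intro poly_eqI) (auto simp: F_def coeff_map_poly)
    then show ?thesis by (simp add: poly_monom)
  qed
  have z_pow: "z ^ m = cis (2 * pi * real m / real n)" for m
    by (simp add: z_def DeMoivre mult_ac)
  have z_primitive: "z ^ m \<noteq> 1" if "0 < m" "m < n" for m
  proof
    assume "z ^ m = 1"
    then have "cis (2 * pi * real m / real n) = cis (2 * pi * real 0 / real n)"
      by (simp add: z_pow)
    moreover have "inj_on (\<lambda>k. cis (2 * pi * real k / real n)) {..<n}"
      using bij_betw_roots_unity[OF n] by (simp add: bij_betw_def)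
    ultimately have "m = 0" using that n inj_onD[of "\<lambda>k. cis (2 * pi * real k / real n)" "{..<n}" m 0] by blast
    with that show False by simp
  qed
  have evn: "poly (map_poly of_int (F n)) z = 0" using n by (simp add: ev z_pow)
  have "coeff (F n) n = 1" using n by (simp add: F_def)
  then have "F n \<noteq> 0" by auto
  then obtain Q where Q: "prime Q" "Q dvd F n" "poly (map_poly of_int Q) z = 0"
    using prime_factor_with_root evn by blast
  have "degree Q > 0"
  proof (rule ccontr)
    assume "\<not> degree Q > 0"
    then obtain c where "Q = [:c:]" using degree_eq_zeroE by auto
    with Q show False by (auto simp: map_poly_pCons)
  qed
  then obtain k where k: "\<not> is_unit (poly Q (int (n * k)))" "poly Q (int (n * k)) \<noteq> 0"
    using nonunit_value_at_multiple n by metis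
  define a where "a = n * k"
  obtain p' where p': "prime p'" "p' dvd poly Q (int a)"
    using k prime_divisor_exists[of "poly Q (int a)"] unfolding a_def by metis
  define p where "p = nat p'"
  have p: "prime p" "int p dvd poly Q (int a)"
    using p' by (auto simp: p_def prime_ge_0_int)
  have "poly Q (int a) dvd poly (F n) (int a)"
    using Q(2) by (metis dvdE dvd_triv_left poly_mult)
  with p have "int p dvd int a ^ n - 1" by (auto simp: F_def poly_monom)
  then have cong1: "[int a ^ n = 1] (mod int p)" by (simp add: cong_iff_dvd_diff)
  have pa: "\<not> p dvd a"
  proof
    assume "p dvd a"
    then have "int p dvd int a ^ n" using n by (intro dvd_trans[OF _ dvd_power]) auto
    with \<open>int p dvd int a ^ n - 1\<close> have "int p dvd 1" by (metis dvd_diff_right_iff)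
    with p(1) show False by simp
  qed
  have odvd: "ord p a dvd n"
  proof -
    from cong1 have "[int (a ^ n) = int 1] (mod int p)" by simp
    then show ?thesis using ord_divides cong_int_iff by blast
  qed
  have "ord p a = n"
  proof (rule ccontr)
    assume ne: "ord p a \<noteq> n"
    from odvd obtain t where t: "n = ord p a * t" by blast
    with ne n have "t \<noteq> 1" "t > 0" by (auto intro: Nat.gr0I)
    then obtain q where q: "prime q" "q dvd t" using prime_factor_nat by blast
    define m where "m = n div q"
    have qn: "q dvd n" using q t by simp
    have n_eq: "n = m * q" using qn by (simp add: m_def)
    have m: "m > 0" "m < n" using n_eq n prime_gt_1_nat[OF q(1)] by auto
    have "ord p a dvd m"
    proof -
      from q obtain r where "t = q * r" by blast
      then have "m = ord p a * r" unfolding m_def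
        using t q(1) by (metis mult.left_commute nonzero_mult_div_cancel_left not_prime_0)
      then show ?thesis by simp
    qed
    then have am: "[int (a ^ m) = int 1] (mod int p)" using ord_divides cong_int_iff by blast
    define R where "R = (\<Sum>i<q. monom (1::int) m ^ i)"
    have "monom (1::int) n = monom 1 m ^ q" by (simp add: n_eq monom_power)
    then have "F n = F m * R" by (simp add: F_def R_def power_diff_1_eq)
    moreover have "\<not> Q dvd F m"
    proof
      assume "Q dvd F m"
      then obtain S where "F m = Q * S" by blast
      then have "poly (map_poly of_int (F m)) z = 0" using Q(3) by (simp add: of_int_poly_mult)
      then show False using z_primitive[OF m] by (simp add: ev)
    qed
    ultimately have "Q dvd R" using Q(1,2) prime_dvd_mult_iff by metis
    then have "poly Q (int a) dvd poly R (int a)"  by (metis dvdE dvd_triv_left poly_mult)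
    with p(2) have "int p dvd poly R (int a)" by (rule dvd_trans)
    moreover have "[poly R (int a) = (\<Sum>i<q. 1 ^ i)] (mod int p)"
      unfolding R_def poly_sum poly_power poly_monom using am by (intro cong_sum cong_pow) simp
    ultimately have "int p dvd int q" by (simp add: cong_dvd_iff)
    then have "p = q" using p(1) q(1) by (simp add: primes_dvd_imp_eq)
    with qn pa show False by (simp add: a_def)
  qed
  with p(1) that show ?thesis by blast
qed

section \<open>Quadratic residues modulo such a prime\<close>

lemma QuadRes_mult: "QuadRes p a \<Longrightarrow> QuadRes p b \<Longrightarrow> QuadRes p (a * b)"
  unfolding QuadRes_def by (metis cong_mult power_mult_distrib)

text \<open>
  With \<open>t\<close> a primitive eighth root of unity, \<open>t\<^sup>2\<close> is a square root of \<open>-1\<close>, and \<open>t + 1 / t\<close>, where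
  \<open>1 / t = t ^ 7\<close>, is a square root of \<open>2\<close>.
\<close>
lemma QuadRes_minus_one_and_two:
  fixes p :: nat and t :: int
  assumes "[t^4 = -1] (mod int p)"
  shows "QuadRes p (-1)" "QuadRes p 2"
proof -
  show "QuadRes p (-1)" unfolding QuadRes_def using assms by (intro exI[of _ "t^2"]) simp
  \<comment> \<open>polynomial division of the left-hand side by \<open>t ^ 4 + 1\<close>\<close>
  have "(t + t^7)^2 - 2 = (t^4 + 1) * (t^10 - t^6 + 2 * t^4 + t^2 - 2)"
    by (simp add: power_numeral_reduce algebra_simps)
  moreover have "int p dvd t^4 + 1" using assms by (simp add: cong_iff_dvd_diff)
  ultimately have "[(t + t^7)^2 = 2] (mod int p)" by (simp add: cong_iff_dvd_diff)
  then show "QuadRes p 2" unfolding QuadRes_def by blast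
qed

text \<open>
  Quadratic reciprocity: its sign is \<open>+1\<close> since \<open>p\<close> is \<open>1\<close> modulo \<open>4\<close>, and \<open>p\<close> is the square \<open>1\<close>
  modulo \<open>q\<close>.
\<close>
lemma QuadRes_odd_prime:
  fixes p q :: nat
  assumes "prime p" "prime q" "q \<noteq> 2" "[p = 1] (mod 4)" "[p = 1] (mod q)"
  shows "QuadRes p q"
proof -
  have q2: "2 < q" using assms prime_ge_2_nat[of q] by linarith
  have p2: "2 < p"
    using assms(1,4) prime_ge_2_nat[of p] by (cases "p = 2") (auto simp: cong_def)
  have "p \<noteq> q" using assms(2,5) by (auto simp: cong_def)
  have "[int p = 1] (mod int q)" using assms(5) by (metis cong_int_iff of_nat_1)
  then have "Legendre p q = 1"
    using q2 unfolding Legendre_def QuadRes_def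
    by (auto simp: cong_def intro!: exI[of _ "1::int"])
  moreover have "even ((p - 1) div 2)"
  proof -
    have "4 dvd p - 1" using assms(4) p2 by (simp add: cong_altdef_nat)
    then obtain j where "p - 1 = 4 * j" by (rule dvdE)
    then show ?thesis by simp
  qed
  ultimately have "Legendre q p = 1"
    using Quadratic_Reciprocity[OF assms(1) p2 assms(2) q2 \<open>p \<noteq> q\<close>] by simp
  then show ?thesis by (auto simp: Legendre_def split: if_splits)
qed

lemma QuadRes_all_divisors:
  fixes p m k :: nat
  assumes p: "prime p" "[p = 1] (mod 4)" "[p = 1] (mod m)" and "QuadRes p 2"
    and "k dvd m" "m > 0"
  shows "QuadRes p k"
  using assms(5)
proof (induction k rule: prime_divisors_induct)
  case zero
  then show ?case using assms by simp
next
  case (unit k)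
  then show ?case by (auto simp: QuadRes_def intro!: exI[of _ "1::int"])
next
  case (factor q k)
  have "q dvd m" "k dvd m" using factor.prems by (auto dest: dvd_mult_left dvd_mult_right)
  moreover from this have "[p = 1] (mod q)" using p(3) cong_dvd_modulus_nat by blast
  ultimately have "QuadRes p q" "QuadRes p k"
    using QuadRes_odd_prime[of p q] factor assms by (cases "q = 2"; auto)+
  then show ?case by (simp add: QuadRes_mult)
qed

lemma QuadRes_of_order:
  fixes p a m :: nat and d :: int
  assumes p: "prime p" and o: "ord p a = 8 * m" and d: "\<bar>d\<bar> = int m" "d \<noteq> 0"
  shows "[p = 1] (mod m)" "QuadRes p d"
proof -
  have m: "m > 0" using d by auto
  have cop: "coprime p a" using o m ord_eq_0[of p a] by auto
  have "8 * m dvd p - 1"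
    using order_divides_totient[OF cop] o p by (simp add: totient_prime)
  then have p8m: "[p = 1] (mod 8 * m)"
    using prime_ge_1_nat[OF p] by (simp add: cong_altdef_nat cong_sym_eq)
  then show pm: "[p = 1] (mod m)" by (rule cong_dvd_modulus_nat) simp
  have p4: "[p = 1] (mod 4)" by (rule cong_dvd_modulus_nat[OF p8m]) simp
  \<comment> \<open>an eighth root of unity modulo \<open>p\<close>, primitive because \<open>a\<close> has order exactly \<open>8 * m\<close>\<close>
  define t where "t = int a ^ m"
  have "[a ^ (8 * m) = 1] (mod p)" "\<not> [a ^ (4 * m) = 1] (mod p)"
    unfolding ord_divides o using m by (auto dest: dvd_imp_le)
  then have "[int (a ^ (8 * m)) = int 1] (mod p)" "\<not> [int (a ^ (4 * m)) = int 1] (mod p)"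
    unfolding cong_int_iff .
  then have "[t ^ 8 = 1] (mod p)" "\<not> [t ^ 4 = 1] (mod p)"
    unfolding t_def by (simp_all add: power_mult[symmetric] mult.commute)
  then have "int p dvd t^8 - 1" "\<not> int p dvd t^4 - 1" by (simp_all add: cong_iff_dvd_diff)
  moreover have "t^8 - 1 = (t^4 - 1) * (t^4 + 1)" by (simp add: algebra_simps flip: power_add)
  ultimately have "int p dvd t^4 + 1" using p by (simp add: prime_dvd_mult_iff)
  then have "[t^4 = -1] (mod p)" by (simp add: cong_iff_dvd_diff)
  note qr = QuadRes_minus_one_and_two[OF this]
  have "QuadRes p (int m)" using QuadRes_all_divisors[OF p p4 pm qr(2)] m by simp
  moreover have "d = int m \<or> d = -1 * int m" using d(1) by linarith
  ultimately show "QuadRes p d" using QuadRes_mult[OF qr(1)] by metis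
qed

section \<open>Norms in the square class of a prime\<close>

text \<open>
  The box of side lengths \<open>sqrt (p * e)\<close>, \<open>sqrt p\<close> and \<open>sqrt e\<close> holds more than \<open>p * e\<close> integer points,
  and the two congruences cut out a lattice of index at most \<open>p * e\<close>. So two points of the box differ
  by a nonzero vector of the lattice.
\<close>
lemma box_pigeonhole:
  fixes e p :: nat and c :: int
  assumes "e > 0" "p > 0"
  obtains x y z :: int where "(x, y, z) \<noteq> (0, 0, 0)"
    "x^2 \<le> int (p * e)" "y^2 \<le> int p" "z^2 \<le> int e" "[x = z] (mod int e)" "[x = c * y] (mod int p)"
proof -
  define X Y Z where "X = floor_sqrt (p * e)" and "Y = floor_sqrt p" and "Z = floor_sqrt e"
  define B where "B = {0..int X} \<times> {0..int Y} \<times> {0..int Z}"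
  define g where "g = (\<lambda>(x, y, z). ((x - z) mod int e, (x - c * y) mod int p))"
  have "g ` B \<subseteq> {0..<int e} \<times> {0..<int p}"
    using assms by (auto simp: g_def)
  then have "card (g ` B) \<le> card ({0..<int e} \<times> {0..<int p})"
    by (intro card_mono) auto
  also have "\<dots> = e * p" by (simp add: card_cartesian_product)
  also have "e * p < card B"
  proof -
    have "p * e < (Suc X)^2" "p < (Suc Y)^2" "e < (Suc Z)^2"
      unfolding X_def Y_def Z_def by (rule Suc_floor_sqrt_power2_gt)+
    then have "(p * e) * (p * e) < (Suc X)^2 * ((Suc Y)^2 * (Suc Z)^2)"
      by (intro mult_strict_mono) auto
    then have "(e * p)^2 < (Suc X * (Suc Y * Suc Z))^2"
      by (simp only: power_mult_distrib) (simp add: power2_eq_square mult_ac)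
    then have "e * p < Suc X * (Suc Y * Suc Z)" by (rule power_less_imp_less_base) simp
    also have "\<dots> = card B" by (simp add: B_def card_cartesian_product nat_add_distrib)
    finally show ?thesis .
  qed
  finally have "\<not> inj_on g B" by (rule pigeonhole)
  then obtain b b' where b: "b \<in> B" "b' \<in> B" "b \<noteq> b'" "g b = g b'"
    unfolding inj_on_def by blast
  obtain x y z x' y' z' where "b = (x, y, z)" "b' = (x', y', z')" by (metis prod_cases3)
  with b have mem: "(x, y, z) \<in> B" "(x', y', z') \<in> B"
    and ne: "(x, y, z) \<noteq> (x', y', z')" and eq: "g (x, y, z) = g (x', y', z')"
    by simp_all
  have sq: "(i - j)^2 \<le> int n"
    if "i \<in> {0..int (floor_sqrt n)}" "j \<in> {0..int (floor_sqrt n)}" for i j n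
  proof -
    have "\<bar>i - j\<bar> \<le> int (floor_sqrt n)" using that by auto
    then have "\<bar>i - j\<bar>^2 \<le> (int (floor_sqrt n))^2" by (intro power_mono) auto
    also have "\<dots> \<le> int n" using floor_sqrt_power2_le[of n] by (metis of_nat_le_iff of_nat_power)
    finally show ?thesis by simp
  qed
  show ?thesis
  proof (rule that[of "x - x'" "y - y'" "z - z'"])
    show "(x - x')^2 \<le> int (p * e)" "(y - y')^2 \<le> int p" "(z - z')^2 \<le> int e"
      using mem by (auto simp: B_def X_def Y_def Z_def simp del: of_nat_mult intro!: sq)
    have "int e dvd (x - z) - (x' - z')" "int p dvd (x - c * y) - (x' - c * y')"
      using eq by (auto simp: g_def mod_eq_dvd_iff)
    then show "[x - x' = z - z'] (mod int e)" "[x - x' = c * (y - y')] (mod int p)"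
      by (auto simp: cong_iff_dvd_diff algebra_simps)
    show "(x - x', y - y', z - z') \<noteq> (0, 0, 0)" using ne by auto
  qed
qed

text \<open>
  On the lattice of \<open>box_pigeonhole\<close> the form \<open>F = x\<^sup>2 + d * y\<^sup>2 - p * z\<^sup>2\<close> is divisible by \<open>p * d\<close>:
  modulo \<open>p\<close> since \<open>c\<^sup>2 + d\<close> vanishes, and modulo \<open>d\<close> since \<open>p\<close> is \<open>1\<close> there. The size of the box
  then leaves only \<open>F = 0\<close> and \<open>F = p * d\<close>. In the first case \<open>p * z\<^sup>2\<close> is a norm. In the second case
  \<open>p * (z\<^sup>2 + d)\<close> is one, and multiplying it by the norm \<open>z\<^sup>2 + d\<close> of \<open>(z, 1)\<close> gives \<open>p * (z\<^sup>2 + d)\<^sup>2\<close>.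
\<close>
lemma square_class_of_prime_is_norm:
  fixes p :: nat and d c :: int
  assumes p: "prime p" "\<not> int p dvd d" and d: "\<And>k. k^2 \<noteq> -d" "\<bar>d\<bar> > 1"
    and pd: "[int p = 1] (mod d)" and c: "[c^2 = -d] (mod int p)"
  obtains x y k where "k \<noteq> 0" "x^2 + d * y^2 = int p * k^2"
proof -
  define e where "e = nat \<bar>d\<bar>"
  have e: "int e = \<bar>d\<bar>" "e > 0" using d by (auto simp: e_def)
  have norm0: "x = 0 \<and> y = 0" if "x^2 + d * y^2 = 0" for x y
  proof (cases "y = 0")
    case False
    have "x^2 = y^2 * (- d)" using that by (simp add: algebra_simps)
    then have "y^2 dvd x^2" by (rule dvdI)
    then have "y dvd x" by simp
    then obtain k where k: "x = y * k" by (rule dvdE)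
    then have "y^2 * k^2 = y^2 * (- d)" using \<open>x^2 = _\<close> by (simp add: power_mult_distrib)
    then have "k^2 = - d" using False by (metis mult_left_cancel power_not_zero)
    with d(1) show ?thesis by blast
  qed (use that in simp)
  obtain x y z where ne: "(x, y, z) \<noteq> (0, 0, 0)" and bounds: "x^2 \<le> int (p * e)" "y^2 \<le> int p" "z^2 \<le> int e"
    and cong: "[x = z] (mod int e)" "[x = c * y] (mod int p)"
    by (rule box_pigeonhole[OF e(2) prime_gt_0_nat[OF p(1)], of c])
  define F where "F = x^2 + d * y^2 - int p * z^2"
  \<comment> \<open>neither \<open>p * e\<close> nor \<open>p\<close> is a square; the strictness excludes the extreme values of \<open>F\<close>\<close>
  have x_strict: "x^2 < int p * int e"
  proof -
    have "x^2 \<noteq> int p * int e"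
    proof
      assume eq: "x^2 = int p * int e"
      then have "int p dvd x" using p(1) by (metis dvd_triv_left prime_dvd_power prime_nat_int_transfer)
      then have "int p * int p dvd x^2" by (simp add: power2_eq_square mult_dvd_mono)
      then have "int p dvd int e" using eq p(1) by simp
      then show False using p(2) e(1) by simp
    qed
    then show ?thesis using bounds by simp
  qed
  have y_strict: "y^2 < int p"
  proof -
    have "y^2 \<noteq> int p"
    proof
      assume eq: "y^2 = int p"
      then have "prime (y^2)" using p(1) by simp
      then show False by (simp add: prime_power_iff)
    qed
    then show ?thesis using bounds by simp
  qed
  have ey: "int e * y^2 < int p * int e" "int e * y^2 \<ge> 0" using y_strict e(2) by simp_all
  have ez: "int p * z^2 \<le> int p * int e" "int p * z^2 \<ge> 0"
    using bounds by (simp_all add: mult_left_mono)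
  have "int p dvd F"
  proof -
    have "[x^2 + d * y^2 - int p * z^2 = (c * y)^2 + d * y^2 - 0 * z^2] (mod int p)"
      using cong by (intro cong_diff cong_add cong_pow cong_mult) (simp_all add: cong_0_iff)
    also have "(c * y)^2 + d * y^2 - 0 * z^2 = (c^2 + d) * y^2" by (simp add: algebra_simps power_mult_distrib)
    also have "[\<dots> = 0] (mod int p)" using c by (simp add: cong_iff_dvd_diff)
    finally show ?thesis by (simp add: F_def cong_iff_dvd_diff)
  qed
  moreover have "d dvd F"
  proof -
    have "[x = z] (mod d)" using cong(1) e by (simp add: cong_iff_dvd_diff)
    then have "[x^2 + d * y^2 - int p * z^2 = z^2 + 0 * y^2 - 1 * z^2] (mod d)"
      using pd by (intro cong_diff cong_add cong_pow cong_mult) (simp_all add: cong_0_iff)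
    then show ?thesis by (simp add: F_def cong_iff_dvd_diff)
  qed
  moreover have "coprime (int p) d" using p by (simp add: prime_imp_coprime)
  ultimately have "int p * d dvd F" by (simp add: divides_mult)
  then obtain w where w: "F = int p * d * w" by blast
  note found = that
  have case0: ?thesis if "F = 0"
  proof (rule found[of z x y])
    show "x^2 + d * y^2 = int p * z^2" using \<open>F = 0\<close> by (simp add: F_def)
    show "z \<noteq> 0"
    proof
      assume "z = 0"
      then have "x^2 + d * y^2 = 0" using \<open>F = 0\<close> by (simp add: F_def)
      then have "x = 0 \<and> y = 0" by (rule norm0)
      with ne \<open>z = 0\<close> show False by simp
    qed
  qed
  have case1: ?thesis if "F = int p * d"
  proof (rule found[of "z^2 + d" "x * z + d * y" "x - y * z"])
    show "z^2 + d \<noteq> 0" using d(1)[of z] by auto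
    have "x^2 + d * y^2 = int p * (z^2 + d)" using that by (simp add: F_def algebra_simps)
    then have "(x^2 + d * y^2) * (z^2 + d) = int p * (z^2 + d)^2" by (simp add: power2_eq_square)
    then show "(x * z + d * y)^2 + d * (x - y * z)^2 = int p * (z^2 + d)^2"
      by (simp add: power2_eq_square algebra_simps)
  qed
  have "w = 0 \<or> w = 1"
  proof (cases "d > 0")
    case True
    then have "int e = d" using e by simp
    then have d_eq: "d = int e" by simp
    have "F < int p * d * 2"
      using x_strict ey ez unfolding F_def d_eq by linarith
    moreover have "int p * d * (-1) \<le> F"
      using ey ez zero_le_power2[of x] unfolding F_def d_eq by linarith
    \<comment> \<open>the boundary value needs \<open>x = y = 0\<close>, hence \<open>d dvd z\<close>, which \<open>z\<^sup>2 \<le> d\<close> excludes for \<open>d > 1\<close>\<close>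
    moreover have "F \<noteq> int p * d * (-1)"
    proof
      assume "F = int p * d * (-1)"
      then have "x^2 + d * y^2 = int p * (z^2 - d)" by (simp add: F_def algebra_simps)
      moreover have "z^2 - d \<le> 0" using bounds \<open>int e = d\<close> by simp
      ultimately have "x^2 + d * y^2 \<le> 0" by (simp add: mult_nonneg_nonpos)
      moreover have "x^2 \<ge> 0" "d * y^2 \<ge> 0" using True by auto
      ultimately have xy0: "x = 0 \<and> y = 0" by (intro norm0) linarith
      then have "d dvd z" using cong(1) \<open>int e = d\<close> by (simp add: cong_iff_dvd_diff)
      have "z \<noteq> 0" using ne xy0 by auto
      then have "\<bar>d\<bar> \<le> \<bar>z\<bar>" using \<open>d dvd z\<close> dvd_imp_le_int by blast
      then have "d * d \<le> \<bar>z\<bar> * \<bar>z\<bar>" using True by (intro mult_mono) auto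
      also have "\<dots> \<le> d" using bounds \<open>int e = d\<close> by (simp add: power2_eq_square)
      finally show False using d(2) True by (simp add: mult_le_cancel_left1)
    qed
    ultimately have "int p * d * w < int p * d * 2" "int p * d * (-1) < int p * d * w"
      unfolding w by simp_all
    moreover have "int p * d > 0" using True prime_gt_0_nat[OF p(1)] by simp
    ultimately have "w < 2" "-1 < w" by (simp_all only: mult_less_cancel_left_pos)
    then show ?thesis by auto
  next
    case False
    then have d_eq: "d = - int e" using e by simp
    have "F < int p * (-d)"
      using x_strict ey ez unfolding F_def d_eq minus_minus mult_minus_left by linarith
    moreover have "int p * (-d) * (-2) < F"
      using ey ez zero_le_power2[of x] unfolding F_def d_eq minus_minus mult_minus_left by linarith
    ultimately have "int p * (-d) * (-w) < int p * (-d) * 1" "int p * (-d) * (-2) < int p * (-d) * (-w)"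
      unfolding w by simp_all
    moreover have "int p * (-d) > 0" using False d(2) prime_gt_0_nat[OF p(1)] by (simp add: mult_pos_neg)
    ultimately have "-w < 1" "-2 < -w" by (simp_all only: mult_less_cancel_left_pos)
    then show ?thesis by auto
  qed
  with case0 case1 w show ?thesis by auto
qed

text \<open>
  If \<open>d = - k\<^sup>2\<close>, the norm of \<open>(3 * k, 1)\<close> is \<open>8 * k\<^sup>2\<close>. If \<open>d = 1\<close>, the norm of \<open>(1, 1)\<close> is \<open>2\<close>. In all
  other cases some \<open>p * k\<^sup>2\<close> with \<open>p\<close> prime is a norm.
\<close>
lemma exists_norm_liouville_minus_one:
  fixes d :: int
  assumes "d \<noteq> 0"
  obtains x y where "x^2 + d * y^2 > 0" "liouville (nat (x^2 + d * y^2)) = -1"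
proof -
  have l2: "liouville (nat 2) = -1" by (simp add: liouville_prime)
  consider k where "k^2 = -d" | "d = 1" | "\<And>k. k^2 \<noteq> -d" "\<bar>d\<bar> > 1"
  proof -
    have "1^2 = - d \<or> d = 1 \<or> \<bar>d\<bar> > 1" using assms by simp linarith
    then have "(\<exists>k. k^2 = - d) \<or> d = 1 \<or> (\<forall>k. k^2 \<noteq> - d) \<and> \<bar>d\<bar> > 1" by blast
    then show ?thesis using that by metis
  qed
  then show ?thesis
  proof cases
    case 1
    then have "k \<noteq> 0" using assms by auto
    have eq: "(3 * k)^2 + d * 1^2 = k^2 * (2^2 * 2)" using 1 by (simp add: power_mult_distrib)
    have "liouville (nat (k^2 * (2^2 * 2))) = liouville (nat (2^2 * 2))"
      using \<open>k \<noteq> 0\<close> by (intro liouville_nat_square_mult) auto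
    also have "\<dots> = liouville (nat 2)" by (intro liouville_nat_square_mult) auto
    finally have "liouville (nat (k^2 * (2^2 * 2))) = -1" unfolding l2 .
    moreover have "k^2 * (2^2 * 2) > 0" using \<open>k \<noteq> 0\<close> by simp
    ultimately show ?thesis by (intro that[of "3 * k" 1]) (simp_all only: eq)
  next
    case 2
    then show ?thesis using l2 by (intro that[of 1 1]) auto
  next
    case 3
    define m where "m = nat \<bar>d\<bar>"
    have m: "\<bar>- d\<bar> = int m" "8 * m > 0" "m > 1" using 3(2) by (auto simp: m_def)
    obtain p a :: nat where p: "prime p" and a: "ord p a = 8 * m"
      by (rule exists_prime_with_element_of_order[OF m(2)])
    have pm: "[p = 1] (mod m)" and "QuadRes p (- d)"
      using QuadRes_of_order[OF p a m(1)] assms by simp_all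
    then obtain c where c: "[c^2 = - d] (mod int p)" by (auto simp: QuadRes_def)
    have "[int p = int 1] (mod int m)" using pm by (simp only: cong_int_iff)
    then have pd: "[int p = 1] (mod d)" by (simp add: cong_iff_dvd_diff flip: m(1))
    have "\<not> int p dvd d"
    proof
      assume "int p dvd d"
      then have "[int p = 1] (mod int p)" using pd cong_dvd_modulus by blast
      then show False using prime_gt_1_nat[OF p] by (simp add: cong_def)
    qed
    then obtain x y k where "k \<noteq> 0" and eq: "x^2 + d * y^2 = int p * k^2"
      by (rule square_class_of_prime_is_norm[OF p _ 3 pd c])
    have "int p > 0" using p by (simp add: prime_gt_0_nat)
    then have "k^2 * int p > 0" using \<open>k \<noteq> 0\<close> by simp
    moreover have "liouville (nat (k^2 * int p)) = liouville (nat (int p))"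
      using \<open>int p > 0\<close> \<open>k \<noteq> 0\<close> by (rule liouville_nat_square_mult)
    then have "liouville (nat (k^2 * int p)) = -1"
      using p by (simp only: nat_int liouville_prime)
    ultimately show ?thesis
      using eq by (intro that[of x y]) (simp_all only: mult.commute)
  qed
qed

section \<open>Sign changes\<close>

lemma infinite_sign_if_unbounded:
  fixes d s :: int
  assumes "\<And>N. \<exists>n\<ge>N. n^2 + d > 0 \<and> liouville (nat (n^2 + d)) = s"
  shows "infinite {n::nat. n > 0 \<and> (int n)^2 + d > 0 \<and> liouville (nat ((int n)^2 + d)) = s}"
  unfolding infinite_nat_iff_unbounded_le
proof
  fix m
  obtain n where "n \<ge> int (Suc m)" "n^2 + d > 0" "liouville (nat (n^2 + d)) = s"
    using assms by blast
  then show "\<exists>k\<ge>m. k \<in> {n. n > 0 \<and> (int n)^2 + d > 0 \<and> liouville (nat ((int n)^2 + d)) = s}"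
    by (intro exI[of _ "nat n"]) auto
qed

text \<open>
  The product of two consecutive values of \<open>n\<^sup>2 + d\<close> is again such a value, at a larger argument.
\<close>
lemma liouville_plus_one_unbounded:
  fixes d N :: int
  shows "\<exists>n\<ge>N. n^2 + d > 0 \<and> liouville (nat (n^2 + d)) = 1"
proof (rule ccontr)
  assume "\<not> ?thesis"
  then have neg: "liouville (nat (n^2 + d)) = -1" if "n \<ge> N" "n^2 + d > 0" for n
    using that liouville_cases by blast
  \<comment> \<open>large enough for the three values of \<open>n\<^sup>2 + d\<close> involved to be positive, at arguments \<open>\<ge> N\<close>\<close>
  define n where "n = \<bar>N\<bar> + \<bar>d\<bar> + 1"
  have n: "n \<ge> N" "n \<ge> \<bar>d\<bar> + 1" by (auto simp: n_def)
  have "n * 1 \<le> n * n" using n by (intro mult_left_mono) auto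
  then have pos0: "n^2 + d > 0" using n by (simp add: power2_eq_square)
  moreover have "(n + 1)^2 + d = n^2 + d + (2 * n + 1)" by (simp add: power2_eq_square algebra_simps)
  ultimately have pos1: "(n + 1)^2 + d > 0" using n by linarith
  have prod: "(n^2 + d) * ((n + 1)^2 + d) = (n * (n + 1) + d)^2 + d"
    using norm_mult_identity[of n d 1 "n + 1" 1] by simp
  have "n * (n + 1) + d \<ge> N" using pos0 n by (simp add: power2_eq_square algebra_simps)
  moreover have "(n * (n + 1) + d)^2 + d > 0" using pos0 pos1 by (metis prod mult_pos_pos)
  ultimately have "liouville (nat ((n * (n + 1) + d)^2 + d)) = -1" by (rule neg)
  moreover have "liouville (nat ((n^2 + d) * ((n + 1)^2 + d))) = 1"
    using neg[of n] neg[of "n + 1"] n pos0 pos1 by (simp add: liouville_nat_mult)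
  ultimately show False unfolding prod by simp
qed

lemma liouville_minus_one_unbounded:
  fixes d N :: int
  assumes "d \<noteq> 0"
  shows "\<exists>n\<ge>N. n^2 + d > 0 \<and> liouville (nat (n^2 + d)) = -1"
proof (rule ccontr)
  assume "\<not> ?thesis"
  then have pos: "liouville (nat (n^2 + d)) = 1" if "n \<ge> N" "n^2 + d > 0" for n
    using that liouville_cases by blast
  obtain x y where xy: "x^2 + d * y^2 > 0" "liouville (nat (x^2 + d * y^2)) = -1"
    using exists_norm_liouville_minus_one[OF assms] by blast
  with liouville_norm_eq_1[of N d x y] pos assms show False by simp
qed

theorem theorem1p3:
  fixes d :: int
  assumes "d \<noteq> 0"
  shows "liouville_changes_sign_inf_often (\<lambda>x. x ^ 2 + d)"
  unfolding liouville_changes_sign_inf_often_def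
  using infinite_sign_if_unbounded[OF liouville_plus_one_unbounded]
    infinite_sign_if_unbounded[OF liouville_minus_one_unbounded[OF assms]]
  by simp

end
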